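(* Let $\mathcal{H}$ be a separable complex Hilbert space, let $\{T(t)\}_{t\in\mathbb{R}}$ be a weakly measurable family of densely defined, closed operators in $\mathcal{H}$, and let $\boldsymbol{\mathcal{T}}$ be the associated maximally defined operator in $L^2(\mathbb{R};\mathcal{H})$. If $$\mathcal{D}=\big\{f\in L^2(\mathbb{R};\mathcal{H})\,\big|\, f(t)\in\operatorname{dom}(T(t))\text{ for a.e. }t\in\mathbb{R}\big\},$$ then $\overline{\mathcal{D}}=\overline{\operatorname{dom}(\boldsymbol{\mathcal{T}})}$, where the closures are taken in $L^2(\mathbb{R};\mathcal{H})$.
   Context: The scalar product $(\cdot,\cdot)_{\mathcal{H}}$ is linear in the second argument. A family of vectors $\{g(t)\}_{t\in\mathbb{R}}\subset\mathcal{H}$ is called weakly measurable if $t\mapsto (h,g(t))_{\mathcal{H}}$ is Lebesgue measurable for every $h\in\mathcal{H}$. A family $\{T(t)\}_{t\in\mathbb{R}}$ of densely defined, closed, linear operators in $\mathcal{H}$ is called weakly measurable if for every weakly measurable family of vectors $\{f(t)\}_{t\in\mathbb{R}}$ in $\mathcal{H}$ with $f(t)\in\operatorname{dom}(T(t))$ for all $t\in\mathbb{R}$, the family of vectors $\{T(t)f(t)\}_{t\in\mathbb{R}}$ is weakly measurable. $L^2(\mathbb{R};\mathcal{H})$ is the Hilbert space of (a.e. equivalence classes of) weakly Lebesgue measurable functions $f:\mathbb{R}\to\mathcal{H}$ with $\int_{\mathbb{R}}\|f(t)\|_{\mathcal{H}}^2\,dt<\infty$. The operator $\boldsymbol{\mathcal{T}}$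 in $L^2(\mathbb{R};\mathcal{H})$ associated with $\{T(t)\}_{t\in\mathbb{R}}$ is maximally defined by $(\boldsymbol{\mathcal{T}}f)(t)=T(t)f(t)$ for a.e. $t\in\mathbb{R}$, with $$\operatorname{dom}(\boldsymbol{\mathcal{T}})=\Big\{g\in L^2(\mathbb{R};\mathcal{H})\,\Big|\, g(t)\in\operatorname{dom}(T(t))\text{ for a.e. }t\in\mathbb{R},\ t\mapsto T(t)g(t)\text{ is weakly measurable},\ \int_{\mathbb{R}}\|T(t)g(t)\|_{\mathcal{H}}^2\,dt<\infty\Big\}.$$ *)

theory Defs
  imports "HOL-Analysis.Analysis"
begin

section \<open>Separable complex Hilbert spaces\<close>

text \<open>The scalar product is linear in the second argument.\<close>

class complex_inner = real_normed_vector +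
  fixes scaleC :: "complex \<Rightarrow> 'a \<Rightarrow> 'a" (infixr "*\<^sub>C" 75)
    and cinner :: "'a \<Rightarrow> 'a \<Rightarrow> complex"
  assumes scaleC_add_right: "a *\<^sub>C (x + y) = a *\<^sub>C x + a *\<^sub>C y"
    and scaleC_add_left: "(a + b) *\<^sub>C x = a *\<^sub>C x + b *\<^sub>C x"
    and scaleC_scaleC: "a *\<^sub>C b *\<^sub>C x = (a * b) *\<^sub>C x"
    and scaleC_one: "1 *\<^sub>C x = x"
    and scaleR_scaleC: "r *\<^sub>R x = complex_of_real r *\<^sub>C x"
    and cinner_commute: "cinner x y = cnj (cinner y x)"
    and cinner_add_right: "cinner x (y + z) = cinner x y + cinner x z"
    and cinner_scaleC_right: "cinner x (a *\<^sub>C y) = a * cinner x y"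
    and cinner_self: "cinner x x = complex_of_real ((norm x)\<^sup>2)"

class separable_complex_hilbert_space = complex_inner + complete_space +
  assumes countable_dense: "\<exists>S. countable S \<and> (\<forall>U. open U \<and> U \<noteq> {} \<longrightarrow> S \<inter> U \<noteq> {})"

lemma separable:
  "separable_space (euclidean :: 'a::separable_complex_hilbert_space topology)"
proof -
  obtain S :: "'a set" where S: "countable S" "\<And>U. open U \<Longrightarrow> U \<noteq> {} \<Longrightarrow> S \<inter> U \<noteq> {}"
    using countable_dense by blast
  have "closure S = UNIV"
    using S(2)[of "- closure S"] closure_subset[of S] by (auto simp: open_Compl)
  with S(1) show ?thesis
    by (auto simp: separable_space_def)
qed

lemma cinner_add_left:
  fixes x y z :: "'a::complex_inner"
  shows "cinner (x + y) z = cinner x z + cinner y z"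
  by (metis cinner_commute cinner_add_right complex_cnj_add)

lemma cinner_scaleC_left:
  fixes x y :: "'a::complex_inner"
  shows "cinner (a *\<^sub>C x) y = cnj a * cinner x y"
  by (metis cinner_commute cinner_scaleC_right complex_cnj_mult)

lemma cinner_scaleR_right:
  fixes x y :: "'a::complex_inner"
  shows "cinner x (r *\<^sub>R y) = complex_of_real r * cinner x y"
  by (simp add: scaleR_scaleC cinner_scaleC_right)

lemma cinner_minus_right:
  fixes x y :: "'a::complex_inner"
  shows "cinner x (- y) = - cinner x y"
proof -
  have "cinner x ((- 1) *\<^sub>R y) = complex_of_real (- 1) * cinner x y"
    by (rule cinner_scaleR_right)
  then show ?thesis by simp
qed

lemma cinner_diff_right:
  fixes x y z :: "'a::complex_inner"
  shows "cinner x (y - z) = cinner x y - cinner x z"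
  using cinner_add_right[of x y "- z"] by (simp add: cinner_minus_right)

lemma cinner_zero_right:
  fixes x :: "'a::complex_inner"
  shows "cinner x 0 = 0"
  using cinner_diff_right[of x 0 0] by simp

lemma norm_scaleC:
  fixes x :: "'a::complex_inner"
  shows "norm (a *\<^sub>C x) = cmod a * norm x"
proof -
  have "complex_of_real ((norm (a *\<^sub>C x))\<^sup>2) = complex_of_real ((cmod a * norm x)\<^sup>2)"
    unfolding cinner_self[symmetric] cinner_scaleC_left cinner_scaleC_right
    by (simp add: cinner_self power_mult_distrib complex_norm_square[symmetric] mult_ac del: of_real_power)
  then have "(norm (a *\<^sub>C x))\<^sup>2 = (cmod a * norm x)\<^sup>2"
    by (simp only: of_real_eq_iff)
  then show ?thesis
    by (simp add: power2_eq_iff_nonneg)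
qed

lemma power2_norm_add:
  fixes x y :: "'a::complex_inner"
  shows "(norm (x + y))\<^sup>2 = (norm x)\<^sup>2 + (norm y)\<^sup>2 + 2 * Re (cinner x y)"
proof -
  have "complex_of_real ((norm (x + y))\<^sup>2)
      = cinner x x + cinner y y + (cinner x y + cnj (cinner x y))"
    unfolding cinner_self[symmetric]
    by (simp add: cinner_add_left cinner_add_right cinner_commute[of y x])
  then have "Re (complex_of_real ((norm (x + y))\<^sup>2))
      = Re (cinner x x + cinner y y + (cinner x y + cnj (cinner x y)))"
    by (simp only:)
  then show ?thesis by (simp add: cinner_self del: of_real_power)
qed

lemma power2_norm_diff:
  fixes x y :: "'a::complex_inner"
  shows "(norm (x - y))\<^sup>2 = (norm x)\<^sup>2 + (norm y)\<^sup>2 - 2 * Re (cinner x y)"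
  using power2_norm_add[of x "- y"] by (simp add: cinner_minus_right)

lemma Re_cinner:
  fixes x y :: "'a::complex_inner"
  shows "Re (cinner x y) = ((norm (x + y))\<^sup>2 - (norm x)\<^sup>2 - (norm y)\<^sup>2) / 2"
  by (simp add: power2_norm_add)

lemma Im_cinner:
  fixes x y :: "'a::complex_inner"
  shows "Im (cinner x y) = Re (cinner (\<i> *\<^sub>C x) y)"
  by (simp add: cinner_scaleC_left)

lemma power2_norm_add_le:
  fixes x y :: "'a::complex_inner"
  assumes "s > 0"
  shows "(norm (x + y))\<^sup>2 \<le> (1 + s) * (norm x)\<^sup>2 + (1 + 1 / s) * (norm y)\<^sup>2"
proof -
  have "(norm (x + y))\<^sup>2 \<le> (norm x + norm y)\<^sup>2"
    by (simp add: norm_triangle_ineq power_mono)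
  moreover have "0 \<le> (s * norm x - norm y)\<^sup>2 / s"
    using assms by simp
  moreover have "(s * norm x - norm y)\<^sup>2 / s
      = s * (norm x)\<^sup>2 - 2 * norm x * norm y + (norm y)\<^sup>2 / s"
    using assms by (simp add: power2_eq_square field_simps)
  ultimately show ?thesis
    by (simp add: power2_eq_square algebra_simps)
qed

section \<open>Unbounded operators\<close>

text \<open>An operator in a space \<open>'a\<close> is a partial map on \<open>'a\<close>; its domain is \<^term>\<open>dom A\<close>.\<close>

definition linear_operator :: "('a::complex_inner \<rightharpoonup> 'a) \<Rightarrow> bool" where
  "linear_operator A \<longleftrightarrow> 0 \<in> dom A \<and>
    (\<forall>x\<in>dom A. \<forall>y\<in>dom A. x + y \<in> dom A \<and> the (A (x + y)) = the (A x) + the (A y)) \<and>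
    (\<forall>c. \<forall>x\<in>dom A. c *\<^sub>C x \<in> dom A \<and> the (A (c *\<^sub>C x)) = c *\<^sub>C the (A x))"

definition densely_defined :: "('a::complex_inner \<rightharpoonup> 'a) \<Rightarrow> bool" where
  "densely_defined A \<longleftrightarrow> closure (dom A) = UNIV"

definition closed_operator :: "('a::complex_inner \<rightharpoonup> 'a) \<Rightarrow> bool" where
  "closed_operator A \<longleftrightarrow> closed {(x, y). A x = Some y}"

section \<open>Weak measurability\<close>

definition weakly_measurable :: "(real \<Rightarrow> 'a::complex_inner) \<Rightarrow> bool" where
  "weakly_measurable g \<longleftrightarrow> (\<forall>h. (\<lambda>t. cinner h (g t)) \<in> borel_measurable lebesgue)"

definition weakly_measurable_operators :: "(real \<Rightarrow> 'a::complex_inner \<rightharpoonup> 'a) \<Rightarrow> bool" where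
  "weakly_measurable_operators T \<longleftrightarrow>
    (\<forall>f. weakly_measurable f \<and> (\<forall>t. f t \<in> dom (T t)) \<longrightarrow>
      weakly_measurable (\<lambda>t. the (T t (f t))))"

section \<open>The space of square-integrable functions on the real line\<close>

definition square_integrable :: "(real \<Rightarrow> 'a::complex_inner) \<Rightarrow> bool" where
  "square_integrable f \<longleftrightarrow>
    weakly_measurable f \<and> (\<integral>\<^sup>+ t. ennreal ((norm (f t))\<^sup>2) \<partial>lebesgue) < \<infinity>"

lemma weakly_measurable_zero: "weakly_measurable (\<lambda>t. 0)"
  by (simp add: weakly_measurable_def cinner_zero_right)

lemma weakly_measurable_add:
  "weakly_measurable f \<Longrightarrow> weakly_measurable g \<Longrightarrow> weakly_measurable (\<lambda>t. f t + g t)"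
  unfolding weakly_measurable_def cinner_add_right by (auto intro: borel_measurable_add)

lemma weakly_measurable_scaleC:
  "weakly_measurable f \<Longrightarrow> weakly_measurable (\<lambda>t. c *\<^sub>C f t)"
  unfolding weakly_measurable_def cinner_scaleC_right
  by (auto intro: borel_measurable_times borel_measurable_const)

text \<open>By separability, weak measurability makes the norm measurable: for a countable dense set
  \<open>S\<close>, the square of the norm of \<open>x\<close> is the supremum over \<open>d \<in> S\<close> of
  \<open>2 * Re (cinner d x) - (norm d)\<^sup>2\<close>.\<close>

lemma weakly_measurable_norm_power2:
  fixes f :: "real \<Rightarrow> 'a::separable_complex_hilbert_space"
  assumes "weakly_measurable f"
  shows "(\<lambda>t. (norm (f t))\<^sup>2) \<in> borel_measurable lebesgue"
proof -
  obtain S :: "'a set" where S: "countable S" "closure S = UNIV"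
    using separable by (auto simp: separable_space_def)
  have ne: "S \<noteq> {}" using S(2) by auto
  define F where "F = (\<lambda>d t. 2 * Re (cinner d (f t)) - (norm d)\<^sup>2)"
  have F: "F d t = (norm (f t))\<^sup>2 - (norm (f t - d))\<^sup>2" for d t
    by (simp add: F_def power2_norm_diff cinner_commute[of "f t" d])
  have bdd: "bdd_above ((\<lambda>d. F d t) ` S)" for t
    by (rule bdd_aboveI[of _ "(norm (f t))\<^sup>2"]) (auto simp: F)
  have "(SUP d\<in>S. F d t) = (norm (f t))\<^sup>2" for t
  proof (rule antisym)
    show "(SUP d\<in>S. F d t) \<le> (norm (f t))\<^sup>2"
      by (rule cSUP_least[OF ne]) (simp add: F)
    show "(norm (f t))\<^sup>2 \<le> (SUP d\<in>S. F d t)"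
    proof (rule field_le_epsilon)
      fix e :: real assume e: "e > 0"
      have "f t \<in> closure S" using S(2) by simp
      then obtain d where d: "d \<in> S" "dist d (f t) < sqrt e"
        using e unfolding closure_approachable by (meson real_sqrt_gt_zero)
      have "norm (f t - d) < sqrt e"
        using d(2) by (simp add: dist_norm norm_minus_commute)
      then have "(norm (f t - d))\<^sup>2 < (sqrt e)\<^sup>2"
        by (simp add: power_strict_mono)
      then have "(norm (f t))\<^sup>2 \<le> F d t + e"
        using e by (simp add: F)
      also have "F d t \<le> (SUP d\<in>S. F d t)"
        by (rule cSUP_upper[OF d(1) bdd])
      finally show "(norm (f t))\<^sup>2 \<le> (SUP d\<in>S. F d t) + e" by simp
    qed
  qed
  moreover have "(\<lambda>t. SUP d\<in>S. F d t) \<in> borel_measurable lebesgue"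
  proof (rule borel_measurable_cSUP[OF S(1)])
    fix d
    have "(\<lambda>t. cinner d (f t)) \<in> borel_measurable lebesgue"
      using assms by (simp add: weakly_measurable_def)
    then show "F d \<in> borel_measurable lebesgue"
      unfolding F_def by (intro borel_measurable_diff borel_measurable_times borel_measurable_const
          measurable_compose[OF _ borel_measurable_Re])
  qed (rule bdd)
  ultimately show ?thesis by simp
qed

lemma square_integrable_iff:
  fixes f :: "real \<Rightarrow> 'a::separable_complex_hilbert_space"
  shows "square_integrable f \<longleftrightarrow>
    weakly_measurable f \<and> integrable lebesgue (\<lambda>t. (norm (f t))\<^sup>2)"
  using weakly_measurable_norm_power2[of f]
  by (auto simp: square_integrable_def integrable_iff_bounded)

lemma square_integrable_zero: "square_integrable (\<lambda>t. 0)"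
  by (simp add: square_integrable_def weakly_measurable_zero)

lemma square_integrable_scaleC:
  fixes f :: "real \<Rightarrow> 'a::separable_complex_hilbert_space"
  assumes "square_integrable f"
  shows "square_integrable (\<lambda>t. c *\<^sub>C f t)"
  using assms
  by (simp add: square_integrable_iff weakly_measurable_scaleC norm_scaleC power_mult_distrib)

lemma square_integrable_add:
  fixes f g :: "real \<Rightarrow> 'a::separable_complex_hilbert_space"
  assumes "square_integrable f" "square_integrable g"
  shows "square_integrable (\<lambda>t. f t + g t)"
  unfolding square_integrable_iff
proof
  show "weakly_measurable (\<lambda>t. f t + g t)"
    using assms by (simp add: square_integrable_def weakly_measurable_add)
  show "integrable lebesgue (\<lambda>t. (norm (f t + g t))\<^sup>2)"
  proof (rule Bochner_Integration.integrable_bound)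
    show "integrable lebesgue (\<lambda>t. 2 * (norm (f t))\<^sup>2 + 2 * (norm (g t))\<^sup>2)"
      using assms by (simp add: square_integrable_iff)
    show "(\<lambda>t. (norm (f t + g t))\<^sup>2) \<in> borel_measurable lebesgue"
      using assms
      by (intro weakly_measurable_norm_power2 weakly_measurable_add)
        (simp_all add: square_integrable_def)
    have "(norm (f t + g t))\<^sup>2 \<le> 2 * (norm (f t))\<^sup>2 + 2 * (norm (g t))\<^sup>2" for t
      using power2_norm_add_le[of 1 "f t" "g t"] by simp
    then show "AE t in lebesgue. norm ((norm (f t + g t))\<^sup>2)
        \<le> norm (2 * (norm (f t))\<^sup>2 + 2 * (norm (g t))\<^sup>2)"
      by simp
  qed
qed

lemma square_integrable_scaleR:
  fixes f :: "real \<Rightarrow> 'a::separable_complex_hilbert_space"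
  assumes "square_integrable f"
  shows "square_integrable (\<lambda>t. r *\<^sub>R f t)"
  unfolding scaleR_scaleC by (rule square_integrable_scaleC[OF assms])

lemma square_integrable_uminus:
  fixes f :: "real \<Rightarrow> 'a::separable_complex_hilbert_space"
  assumes "square_integrable f"
  shows "square_integrable (\<lambda>t. - f t)"
  using square_integrable_scaleR[OF assms, of "-1"] by simp

lemma square_integrable_diff:
  fixes f g :: "real \<Rightarrow> 'a::separable_complex_hilbert_space"
  assumes "square_integrable f" "square_integrable g"
  shows "square_integrable (\<lambda>t. f t - g t)"
  using square_integrable_add[OF assms(1) square_integrable_uminus[OF assms(2)]] by simp

lemma integrable_cinner:
  fixes f g :: "real \<Rightarrow> 'a::separable_complex_hilbert_space"
  assumes "square_integrable f" "square_integrable g"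
  shows "integrable lebesgue (\<lambda>t. cinner (f t) (g t))"
proof -
  have Re: "integrable lebesgue (\<lambda>t. Re (cinner (u t) (g t)))" if "square_integrable u" for u
    unfolding Re_cinner
    using that assms(2) square_integrable_add[OF that assms(2)]
    by (simp add: square_integrable_iff)
  have "integrable lebesgue (\<lambda>t. Im (cinner (f t) (g t)))"
    unfolding Im_cinner by (rule Re) (rule square_integrable_scaleC[OF assms(1)])
  with Re[OF assms(1)] have "integrable lebesgue (\<lambda>t.
      complex_of_real (Re (cinner (f t) (g t))) + \<i> * complex_of_real (Im (cinner (f t) (g t))))"
    by (intro Bochner_Integration.integrable_add integrable_mult_right integrable_of_real)
  then show ?thesis by (simp only: complex_eq[symmetric])
qed

quotient_type (overloaded) 'a L2 = "real \<Rightarrow> 'a::separable_complex_hilbert_space" / partial: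
  "\<lambda>f g. square_integrable f \<and> square_integrable g \<and> (AE t in lebesgue. f t = g t)"
proof (rule part_equivpI)
  show "\<exists>f::real \<Rightarrow> 'a. square_integrable f \<and> square_integrable f \<and> (AE t in lebesgue. f t = f t)"
    using square_integrable_zero by auto
  show "symp (\<lambda>f g::real \<Rightarrow> 'a. square_integrable f \<and> square_integrable g \<and>
      (AE t in lebesgue. f t = g t))"
    by (auto intro!: sympI)
  show "transp (\<lambda>f g::real \<Rightarrow> 'a. square_integrable f \<and> square_integrable g \<and>
      (AE t in lebesgue. f t = g t))"
    by (intro transpI conjI) (auto elim: AE_mp)
qed

text \<open>\<^term>\<open>rep_L2 f\<close> is some representative of the equivalence class \<open>f\<close>, and \<^term>\<open>abs_L2 g\<close>
  is the class of \<open>g\<close> whenever \<open>g\<close> is square-integrable.\<close>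

lemma square_integrable_rep_L2: "square_integrable (rep_L2 f)"
  using Quotient3_rep_reflp[OF Quotient3_L2] by blast

lemma rep_abs_L2:
  assumes "square_integrable f"
  shows "AE t in lebesgue. rep_L2 (abs_L2 f) t = f t"
  using rep_abs_rsp_left[OF Quotient3_L2, of f f] assms by simp

lemma L2_eqI:
  assumes "AE t in lebesgue. rep_L2 f t = rep_L2 g t"
  shows "f = g"
  using assms Quotient3_rel_rep[OF Quotient3_L2, of f g] square_integrable_rep_L2 by blast

instantiation L2 :: (separable_complex_hilbert_space) complex_inner
begin

definition zero_L2 :: "'a L2" where
  "0 = abs_L2 (\<lambda>t. 0)"

definition plus_L2 :: "'a L2 \<Rightarrow> 'a L2 \<Rightarrow> 'a L2" where
  "f + g = abs_L2 (\<lambda>t. rep_L2 f t + rep_L2 g t)"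

definition uminus_L2 :: "'a L2 \<Rightarrow> 'a L2" where
  "- f = abs_L2 (\<lambda>t. - rep_L2 f t)"

definition minus_L2 :: "'a L2 \<Rightarrow> 'a L2 \<Rightarrow> 'a L2" where
  "f - g = abs_L2 (\<lambda>t. rep_L2 f t - rep_L2 g t)"

definition scaleR_L2 :: "real \<Rightarrow> 'a L2 \<Rightarrow> 'a L2" where
  "r *\<^sub>R f = abs_L2 (\<lambda>t. r *\<^sub>R rep_L2 f t)"

definition scaleC_L2 :: "complex \<Rightarrow> 'a L2 \<Rightarrow> 'a L2" where
  "c *\<^sub>C f = abs_L2 (\<lambda>t. c *\<^sub>C rep_L2 f t)"

definition cinner_L2 :: "'a L2 \<Rightarrow> 'a L2 \<Rightarrow> complex" where
  "cinner f g = (LINT t|lebesgue. cinner (rep_L2 f t) (rep_L2 g t))"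

definition norm_L2 :: "'a L2 \<Rightarrow> real" where
  "norm f = sqrt (LINT t|lebesgue. (norm (rep_L2 f t))\<^sup>2)"

definition sgn_L2 :: "'a L2 \<Rightarrow> 'a L2" where
  "sgn (f :: 'a L2) = inverse (norm f) *\<^sub>R f"

definition dist_L2 :: "'a L2 \<Rightarrow> 'a L2 \<Rightarrow> real" where
  "dist (f :: 'a L2) g = norm (f - g)"

definition uniformity_L2 :: "('a L2 \<times> 'a L2) filter" where
  "uniformity = (INF e\<in>{0 <..}. principal {(f :: 'a L2, g :: 'a L2). dist f g < e})"

definition open_L2 :: "'a L2 set \<Rightarrow> bool" where
  "open (U :: 'a L2 set) \<longleftrightarrow> (\<forall>f\<in>U. eventually (\<lambda>(f', g). f' = f \<longrightarrow> g \<in> U) (uniformity :: ('a L2 \<times> 'a L2) filter))"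

instance
proof -
  have zero: "AE t in lebesgue. rep_L2 (0 :: 'a L2) t = 0"
    unfolding zero_L2_def by (intro rep_abs_L2 square_integrable_zero)
  have plus: "AE t in lebesgue. rep_L2 (f + g) t = rep_L2 f t + rep_L2 g t" for f g :: "'a L2"
    unfolding plus_L2_def
    by (intro rep_abs_L2 square_integrable_add square_integrable_rep_L2)
  have uminus: "AE t in lebesgue. rep_L2 (- f) t = - rep_L2 f t" for f :: "'a L2"
    unfolding uminus_L2_def
    by (intro rep_abs_L2 square_integrable_uminus square_integrable_rep_L2)
  have minus: "AE t in lebesgue. rep_L2 (f - g) t = rep_L2 f t - rep_L2 g t" for f g :: "'a L2"
    unfolding minus_L2_def
    by (intro rep_abs_L2 square_integrable_diff square_integrable_rep_L2)
  have scaleR: "AE t in lebesgue. rep_L2 (r *\<^sub>R f) t = r *\<^sub>R rep_L2 f t" for r and f :: "'a L2"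
    unfolding scaleR_L2_def
    by (intro rep_abs_L2 square_integrable_scaleR square_integrable_rep_L2)
  have scaleC: "AE t in lebesgue. rep_L2 (c *\<^sub>C f) t = c *\<^sub>C rep_L2 f t" for c and f :: "'a L2"
    unfolding scaleC_L2_def
    by (intro rep_abs_L2 square_integrable_scaleC square_integrable_rep_L2)
  have int2: "integrable lebesgue (\<lambda>t. (norm (rep_L2 f t))\<^sup>2)" for f :: "'a L2"
    using square_integrable_rep_L2[of f] by (simp add: square_integrable_iff)
  have intc: "integrable lebesgue (\<lambda>t. cinner (rep_L2 f t) (rep_L2 g t))" for f g :: "'a L2"
    by (intro integrable_cinner square_integrable_rep_L2)
  have norm2: "(norm f)\<^sup>2 = (LINT t|lebesgue. (norm (rep_L2 f t))\<^sup>2)" for f :: "'a L2"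
    by (simp add: norm_L2_def)
  have norm0: "norm f = 0 \<longleftrightarrow> f = 0" for f :: "'a L2"
  proof -
    have "norm f = 0 \<longleftrightarrow> (LINT t|lebesgue. (norm (rep_L2 f t))\<^sup>2) = 0"
      by (simp add: norm_L2_def)
    also have "\<dots> \<longleftrightarrow> (AE t in lebesgue. (norm (rep_L2 f t))\<^sup>2 = 0)"
      by (rule integral_nonneg_eq_0_iff_AE[OF int2]) simp
    also have "\<dots> \<longleftrightarrow> (AE t in lebesgue. rep_L2 f t = 0)" by simp
    also have "\<dots> \<longleftrightarrow> f = 0"
    proof
      assume "AE t in lebesgue. rep_L2 f t = 0"
      with zero have "AE t in lebesgue. rep_L2 f t = rep_L2 0 t" by eventually_elim simp
      then show "f = 0" by (rule L2_eqI)
    qed (use zero in simp)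
    finally show ?thesis .
  qed
  have nonneg: "norm f \<ge> 0" for f :: "'a L2" by (simp add: norm_L2_def)
  have triangle: "norm (f + g) \<le> norm f + norm g" for f g :: "'a L2"
  proof (cases "f = 0 \<or> g = 0")
    case True
    have "f + g = g" if "f = 0"
    proof (rule L2_eqI)
      show "AE t in lebesgue. rep_L2 (f + g) t = rep_L2 g t"
        using plus[of f g] zero unfolding that by eventually_elim simp
    qed
    moreover have "f + g = f" if "g = 0"
    proof (rule L2_eqI)
      show "AE t in lebesgue. rep_L2 (f + g) t = rep_L2 f t"
        using plus[of f g] zero unfolding that by eventually_elim simp
    qed
    ultimately show ?thesis using True nonneg[of f] nonneg[of g] by auto
  next
    case False
    then have pos: "norm f > 0" "norm g > 0"
      using norm0[of f] norm0[of g] nonneg[of f] nonneg[of g] by linarith+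
    define s where "s = norm g / norm f"
    have s: "s > 0" using pos by (simp add: s_def)
    have "(norm (f + g))\<^sup>2
        \<le> (LINT t|lebesgue. (1 + s) * (norm (rep_L2 f t))\<^sup>2 + (1 + 1 / s) * (norm (rep_L2 g t))\<^sup>2)"
      unfolding norm2
    proof (rule integral_mono_AE)
      show "integrable lebesgue (\<lambda>t. (norm (rep_L2 (f + g) t))\<^sup>2)" by (rule int2)
      show "integrable lebesgue
          (\<lambda>t. (1 + s) * (norm (rep_L2 f t))\<^sup>2 + (1 + 1 / s) * (norm (rep_L2 g t))\<^sup>2)"
        by (intro Bochner_Integration.integrable_add integrable_mult_right int2)
      show "AE t in lebesgue. (norm (rep_L2 (f + g) t))\<^sup>2
          \<le> (1 + s) * (norm (rep_L2 f t))\<^sup>2 + (1 + 1 / s) * (norm (rep_L2 g t))\<^sup>2"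
        using plus[of f g] by eventually_elim (simp only: power2_norm_add_le[OF s])
    qed
    also have "\<dots> = (1 + s) * (norm f)\<^sup>2 + (1 + 1 / s) * (norm g)\<^sup>2"
      unfolding norm2 using int2 by simp
    also have "\<dots> = (norm f + norm g)\<^sup>2"
      using pos by (simp add: s_def field_simps power2_eq_square)
    finally show ?thesis
      by (rule power2_le_imp_le) (simp add: nonneg)
  qed
  show "OFCLASS('a L2, complex_inner_class)"
  proof
    fix a b r s :: "real" and c d :: complex and f g h :: "'a L2"
    show "f + g + h = f + (g + h)"
      by (rule L2_eqI)
        (use plus[of "f + g" h] plus[of f g] plus[of f "g + h"] plus[of g h] in
          \<open>eventually_elim, simp add: add_ac\<close>)
    show "f + g = g + f"
      by (rule L2_eqI) (use plus[of f g] plus[of g f] in \<open>eventually_elim, simp add: add_ac\<close>)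
    show "0 + f = f"
      by (rule L2_eqI) (use plus[of 0 f] zero in \<open>eventually_elim, simp\<close>)
    show "- f + f = 0"
      by (rule L2_eqI) (use plus[of "- f" f] uminus[of f] zero in \<open>eventually_elim, simp\<close>)
    show "f - g = f + - g"
      by (rule L2_eqI)
        (use plus[of f "- g"] uminus[of g] minus[of f g] in \<open>eventually_elim, simp\<close>)
    show "r *\<^sub>R (f + g) = r *\<^sub>R f + r *\<^sub>R g"
      by (rule L2_eqI)
        (use plus[of f g] scaleR[of r "f + g"] scaleR[of r f] scaleR[of r g]
          plus[of "r *\<^sub>R f" "r *\<^sub>R g"] in \<open>eventually_elim, simp add: scaleR_add_right\<close>)
    show "(r + s) *\<^sub>R f = r *\<^sub>R f + s *\<^sub>R f"
      by (rule L2_eqI)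
        (use scaleR[of "r + s" f] scaleR[of r f] scaleR[of s f]
          plus[of "r *\<^sub>R f" "s *\<^sub>R f"] in \<open>eventually_elim, simp add: scaleR_add_left\<close>)
    show "r *\<^sub>R s *\<^sub>R f = (r * s) *\<^sub>R f"
      by (rule L2_eqI)
        (use scaleR[of "r * s" f] scaleR[of r "s *\<^sub>R f"] scaleR[of s f] in
          \<open>eventually_elim, simp\<close>)
    show "1 *\<^sub>R f = f"
      by (rule L2_eqI) (use scaleR[of 1 f] in \<open>eventually_elim, simp\<close>)
    show "c *\<^sub>C (f + g) = c *\<^sub>C f + c *\<^sub>C g"
      by (rule L2_eqI)
        (use plus[of f g] scaleC[of c "f + g"] scaleC[of c f] scaleC[of c g]
          plus[of "c *\<^sub>C f" "c *\<^sub>C g"] in \<open>eventually_elim, simp add: scaleC_add_right\<close>)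
    show "(c + d) *\<^sub>C f = c *\<^sub>C f + d *\<^sub>C f"
      by (rule L2_eqI)
        (use scaleC[of "c + d" f] scaleC[of c f] scaleC[of d f]
          plus[of "c *\<^sub>C f" "d *\<^sub>C f"] in \<open>eventually_elim, simp add: scaleC_add_left\<close>)
    show "c *\<^sub>C d *\<^sub>C f = (c * d) *\<^sub>C f"
      by (rule L2_eqI)
        (use scaleC[of "c * d" f] scaleC[of c "d *\<^sub>C f"] scaleC[of d f] in
          \<open>eventually_elim, simp add: scaleC_scaleC\<close>)
    show "1 *\<^sub>C f = f"
      by (rule L2_eqI) (use scaleC[of 1 f] in \<open>eventually_elim, simp add: scaleC_one\<close>)
    show "r *\<^sub>R f = complex_of_real r *\<^sub>C f"
      by (simp add: scaleR_L2_def scaleC_L2_def scaleR_scaleC)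
    show "dist f g = norm (f - g)" by (rule dist_L2_def)
    show "sgn f = inverse (norm f) *\<^sub>R f" by (rule sgn_L2_def)
    show "uniformity = (INF e\<in>{0 <..}. principal {(f, g :: 'a L2). dist f g < e})"
      by (rule uniformity_L2_def)
    show "open U \<longleftrightarrow> (\<forall>f\<in>U. eventually (\<lambda>(f', g). f' = f \<longrightarrow> g \<in> U) uniformity)"
      for U :: "'a L2 set"
      by (rule open_L2_def)
    show "norm f = 0 \<longleftrightarrow> f = 0" by (rule norm0)
    show "norm (f + g) \<le> norm f + norm g" by (rule triangle)
    show "norm (r *\<^sub>R f) = \<bar>r\<bar> * norm f"
    proof -
      have "(LINT t|lebesgue. (norm (rep_L2 (r *\<^sub>R f) t))\<^sup>2)
          = (LINT t|lebesgue. r\<^sup>2 * (norm (rep_L2 f t))\<^sup>2)"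
      proof (rule integral_cong_AE)
        show "(\<lambda>t. (norm (rep_L2 (r *\<^sub>R f) t))\<^sup>2) \<in> borel_measurable lebesgue"
          using int2 by blast
        show "(\<lambda>t. r\<^sup>2 * (norm (rep_L2 f t))\<^sup>2) \<in> borel_measurable lebesgue"
          using int2[of f] by (intro borel_measurable_times) auto
        show "AE t in lebesgue. (norm (rep_L2 (r *\<^sub>R f) t))\<^sup>2 = r\<^sup>2 * (norm (rep_L2 f t))\<^sup>2"
          using scaleR[of r f] by eventually_elim (simp add: power_mult_distrib)
      qed
      then show ?thesis by (simp add: norm_L2_def real_sqrt_mult)
    qed
    show "cinner f g = cnj (cinner g f)"
    proof -
      have "cnj (cinner g f) = (LINT t|lebesgue. cnj (cinner (rep_L2 g t) (rep_L2 f t)))"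
        by (simp add: cinner_L2_def)
      then show ?thesis
        by (simp add: cinner_L2_def cinner_commute[symmetric])
    qed
    show "cinner f (g + h) = cinner f g + cinner f h"
    proof -
      have "(LINT t|lebesgue. cinner (rep_L2 f t) (rep_L2 (g + h) t))
          = (LINT t|lebesgue. cinner (rep_L2 f t) (rep_L2 g t) + cinner (rep_L2 f t) (rep_L2 h t))"
      proof (rule integral_cong_AE)
        show "AE t in lebesgue. cinner (rep_L2 f t) (rep_L2 (g + h) t)
            = cinner (rep_L2 f t) (rep_L2 g t) + cinner (rep_L2 f t) (rep_L2 h t)"
          using plus[of g h] by eventually_elim (simp add: cinner_add_right)
      qed (use intc in \<open>auto intro!: borel_measurable_add\<close>)
      then show ?thesis using intc by (simp add: cinner_L2_def)
    qed
    show "cinner f (c *\<^sub>C g) = c * cinner f g"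
    proof -
      have "(LINT t|lebesgue. cinner (rep_L2 f t) (rep_L2 (c *\<^sub>C g) t))
          = (LINT t|lebesgue. c * cinner (rep_L2 f t) (rep_L2 g t))"
      proof (rule integral_cong_AE)
        show "AE t in lebesgue. cinner (rep_L2 f t) (rep_L2 (c *\<^sub>C g) t)
            = c * cinner (rep_L2 f t) (rep_L2 g t)"
          using scaleC[of c g] by eventually_elim (simp add: cinner_scaleC_right)
      qed (use intc in \<open>auto intro!: borel_measurable_times\<close>)
      then show ?thesis by (simp add: cinner_L2_def)
    qed
    show "cinner f f = complex_of_real ((norm f)\<^sup>2)"
      by (simp add: norm2 cinner_L2_def cinner_self del: of_real_power)
  qed
qed

end

section \<open>The operator associated with a family of operators\<close>

definition associated_operator ::
    "(real \<Rightarrow> 'a::separable_complex_hilbert_space \<rightharpoonup> 'a) \<Rightarrow> 'a L2 \<rightharpoonup> 'a L2" where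
  "associated_operator T g =
    (if (AE t in lebesgue. rep_L2 g t \<in> dom (T t)) \<and>
        weakly_measurable (\<lambda>t. the (T t (rep_L2 g t))) \<and>
        (\<integral>\<^sup>+ t. ennreal ((norm (the (T t (rep_L2 g t))))\<^sup>2) \<partial>lebesgue) < \<infinity>
     then Some (abs_L2 (\<lambda>t. the (T t (rep_L2 g t))))
     else None)"

end

theory Submission
  imports Defs
begin

text \<open>Given \<open>g \<in> \<D>\<close>, change it on a null set so that \<open>g t \<in> dom (T t)\<close> for all \<open>t\<close>; then
  \<open>t \<mapsto> T t (g t)\<close> is weakly measurable, so the sets
  \<open>A\<^sub>n = {t. \<bar>t\<bar> \<le> n \<and> \<parallel>T t (g t)\<parallel>\<^sup>2 \<le> n}\<close> are measurable. They exhaust the line, and the cut-off of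
  \<open>g\<close> to \<open>A\<^sub>n\<close> lies in the domain of the associated operator because \<open>T t (g t)\<close> is bounded on
  the bounded set \<open>A\<^sub>n\<close>. By dominated convergence these cut-offs tend to \<open>g\<close> in \<open>L\<^sup>2\<close>.\<close>

text \<open>Lebesgue measure is complete, so changing a function on a null set cannot destroy
  measurability.\<close>

lemma weakly_measurable_cong_AE:
  assumes "weakly_measurable f" "AE t in lebesgue. f t = g t"
  shows "weakly_measurable g"
  unfolding weakly_measurable_def
proof
  fix h
  show "(\<lambda>t. cinner h (g t)) \<in> borel_measurable lebesgue"
  proof (rule borel_measurable_AE)
    show "(\<lambda>t. cinner h (f t)) \<in> borel_measurable lebesgue"
      using assms(1) by (simp add: weakly_measurable_def)
    show "AE t in lebesgue. cinner h (f t) = cinner h (g t)"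
      using assms(2) by eventually_elim simp
  qed
qed

lemma square_integrable_cong_AE:
  assumes "square_integrable f" "AE t in lebesgue. f t = g t"
  shows "square_integrable g"
proof -
  have "(\<integral>\<^sup>+ t. ennreal ((norm (g t))\<^sup>2) \<partial>lebesgue) = (\<integral>\<^sup>+ t. ennreal ((norm (f t))\<^sup>2) \<partial>lebesgue)"
    by (rule nn_integral_cong_AE) (use assms(2) in \<open>eventually_elim, simp\<close>)
  then show ?thesis
    using assms weakly_measurable_cong_AE[of f g] by (simp add: square_integrable_def)
qed

lemma weakly_measurable_indicator_scaleR:
  assumes "weakly_measurable f" "A \<in> sets lebesgue"
  shows "weakly_measurable (\<lambda>t. indicator A t *\<^sub>R f t)"
  unfolding weakly_measurable_def cinner_scaleR_right
proof
  fix h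
  have "(\<lambda>t. complex_of_real (indicator A t)) \<in> borel_measurable lebesgue"
    by (intro measurable_compose[OF _ borel_measurable_of_real] borel_measurable_indicator assms(2))
  then show "(\<lambda>t. complex_of_real (indicator A t) * cinner h (f t)) \<in> borel_measurable lebesgue"
    using assms(1) by (auto simp: weakly_measurable_def intro: borel_measurable_times)
qed

lemma square_integrable_indicator_scaleR:
  assumes "square_integrable f" "A \<in> sets lebesgue"
  shows "square_integrable (\<lambda>t. indicator A t *\<^sub>R f t)"
proof -
  have "(\<integral>\<^sup>+ t. ennreal ((norm (indicator A t *\<^sub>R f t))\<^sup>2) \<partial>lebesgue)
      \<le> (\<integral>\<^sup>+ t. ennreal ((norm (f t))\<^sup>2) \<partial>lebesgue)"
    by (rule nn_integral_mono) (simp add: indicator_def)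
  with assms show ?thesis
    by (auto simp: square_integrable_def weakly_measurable_indicator_scaleR)
qed

lemma rep_L2_diff: "AE t in lebesgue. rep_L2 (f - g) t = rep_L2 f t - rep_L2 g t"
  unfolding minus_L2_def
  by (intro rep_abs_L2 square_integrable_diff square_integrable_rep_L2)

lemma abs_L2_indicator_tendsto:
  fixes f :: "real \<Rightarrow> 'a::separable_complex_hilbert_space"
  assumes f: "square_integrable f" and A: "\<And>n::nat. A n \<in> sets lebesgue"
    and exhaust: "\<And>t. eventually (\<lambda>n. t \<in> A n) sequentially"
  shows "(\<lambda>n. abs_L2 (\<lambda>t. indicator (A n) t *\<^sub>R f t)) \<longlonglongrightarrow> abs_L2 f"
proof -
  let ?F = "\<lambda>n. abs_L2 (\<lambda>t. indicator (A n) t *\<^sub>R f t)"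
  let ?d = "\<lambda>n t. (norm (rep_L2 (?F n - abs_L2 f) t))\<^sup>2"
  have meas: "?d n \<in> borel_measurable lebesgue" for n
    using square_integrable_rep_L2
    by (intro weakly_measurable_norm_power2) (auto simp: square_integrable_def)
  have "AE t in lebesgue. ?d n t = (norm (indicator (A n) t *\<^sub>R f t - f t))\<^sup>2" for n
    using rep_L2_diff[of "?F n" "abs_L2 f"] rep_abs_L2[OF f]
      rep_abs_L2[OF square_integrable_indicator_scaleR[OF f A[of n]]]
    by eventually_elim simp
  \<comment> \<open>The exceptional null set depends on \<open>n\<close>; the union of these
    countably many sets is still null, so one set serves all \<open>n\<close>.\<close>
  then have d: "AE t in lebesgue. \<forall>n. ?d n t = (norm (indicator (A n) t *\<^sub>R f t - f t))\<^sup>2"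
    by (simp add: AE_all_countable)
  \<comment> \<open>At almost every \<open>t\<close> the integrand is 0 if \<open>t\<close> lies in
    \<open>A n\<close> and the squared norm of \<open>f t\<close> otherwise: it vanishes eventually
    and has an integrable majorant.\<close>
  have "(\<lambda>n. LINT t|lebesgue. ?d n t) \<longlonglongrightarrow> (LINT t|(lebesgue :: real measure). 0)"
  proof (rule integral_dominated_convergence)
    show "integrable lebesgue (\<lambda>t. (norm (f t))\<^sup>2)"
      using f by (simp add: square_integrable_iff)
    show "AE t in lebesgue. (\<lambda>n. ?d n t) \<longlonglongrightarrow> 0"
      using d
    proof eventually_elim
      case (elim t)
      have "eventually (\<lambda>n. ?d n t = 0) sequentially"
        using exhaust[of t] by eventually_elim (simp add: elim)
      then show ?case by (rule tendsto_eventually)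
    qed
    show "AE t in lebesgue. norm (?d n t) \<le> (norm (f t))\<^sup>2" for n
      using d by eventually_elim (simp add: indicator_def)
  qed (use meas in simp_all)
  then have "(\<lambda>n. sqrt (LINT t|lebesgue. ?d n t)) \<longlonglongrightarrow> sqrt 0"
    by (intro tendsto_real_sqrt) simp
  then have "(\<lambda>n. norm (?F n - abs_L2 f)) \<longlonglongrightarrow> 0"
    by (simp add: norm_L2_def)
  then show ?thesis
    by (simp add: LIM_zero_iff tendsto_norm_zero_iff)
qed

text \<open>\<open>associated_operator\<close> tests the representative chosen by
  \<open>rep_L2\<close>, which need not be \<open>f\<close>. Both agree almost everywhere, hence so
  do their images under \<open>T t\<close>, and the conditions carry over.\<close>

lemma abs_L2_in_dom_associated_operator:
  fixes T :: "real \<Rightarrow> 'a::separable_complex_hilbert_space \<rightharpoonup> 'a"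
  assumes f: "square_integrable f" and dom: "\<And>t. f t \<in> dom (T t)"
    and Tf: "square_integrable (\<lambda>t. the (T t (f t)))"
  shows "abs_L2 f \<in> dom (associated_operator T)"
proof -
  let ?r = "rep_L2 (abs_L2 f)"
  have r: "AE t in lebesgue. ?r t = f t" by (rule rep_abs_L2[OF f])
  have "AE t in lebesgue. ?r t \<in> dom (T t)"
    using r by eventually_elim (simp only: dom)
  moreover have "square_integrable (\<lambda>t. the (T t (?r t)))"
    using Tf by (rule square_integrable_cong_AE) (use r in \<open>eventually_elim, simp\<close>)
  ultimately show ?thesis
    by (simp add: domIff associated_operator_def square_integrable_def)
qed

text \<open>The integral is at most \<open>b\<close> times the length of a bounded interval. This
  will serve for the cut-offs of the image of \<open>g\<close>.\<close>

lemma square_integrable_bounded_support: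
  fixes f :: "real \<Rightarrow> 'a::complex_inner"
  assumes "weakly_measurable f"
    and "\<And>t. (norm (f t))\<^sup>2 \<le> b * indicator {- c..c} t"
  shows "square_integrable f"
proof -
  have "(\<integral>\<^sup>+ t. ennreal ((norm (f t))\<^sup>2) \<partial>lebesgue)
      \<le> (\<integral>\<^sup>+ t. ennreal b * indicator {- c..c} t \<partial>lebesgue)"
  proof (rule nn_integral_mono)
    fix t
    show "ennreal ((norm (f t))\<^sup>2) \<le> ennreal b * indicator {- c..c} t"
      using assms(2)[of t] by (auto simp: indicator_def intro: ennreal_leI)
  qed
  also have "\<dots> = ennreal b * emeasure lebesgue {- c..c}"
    by (rule nn_integral_cmult_indicator) simp
  also have "\<dots> < \<infinity>" by (simp add: ennreal_mult_less_top emeasure_lborel_Icc_eq)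
  finally show ?thesis
    using assms(1) by (simp add: square_integrable_def)
qed

theorem lemma4p8:
  fixes T :: "real \<Rightarrow> 'a::separable_complex_hilbert_space \<rightharpoonup> 'a"
    and D :: "'a L2 set"
  assumes "\<And>t. linear_operator (T t)"
    and "\<And>t. densely_defined (T t)"
    and "\<And>t. closed_operator (T t)"
    and "weakly_measurable_operators T"
    and "D = {f. AE t in lebesgue. rep_L2 f t \<in> dom (T t)}"
  shows "closure D = closure (dom (associated_operator T))"
proof
  have "dom (associated_operator T) \<subseteq> D"
    by (auto simp: assms(5) associated_operator_def split: if_splits)
  then show "closure (dom (associated_operator T)) \<subseteq> closure D"
    by (rule closure_mono)
  have "f \<in> closure (dom (associated_operator T))" if "f \<in> D" for f
  proof -
    \<comment> \<open>The default 0 lies in every domain by linearity. Weak measurability of the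
      family speaks only about vectors in the domain for all \<open>t\<close>, not almost
      all.\<close>
    define g where "g = (\<lambda>t. if rep_L2 f t \<in> dom (T t) then rep_L2 f t else 0)"
    have g_eq: "AE t in lebesgue. rep_L2 f t = g t"
      using \<open>f \<in> D\<close> unfolding assms(5) mem_Collect_eq by eventually_elim (simp add: g_def)
    have g: "square_integrable g"
      using square_integrable_rep_L2 g_eq by (rule square_integrable_cong_AE)
    have g_dom: "g t \<in> dom (T t)" for t
      using assms(1)[of t] by (simp add: g_def linear_operator_def)
    define h where "h = (\<lambda>t. the (T t (g t)))"
    have h: "weakly_measurable h"
      using assms(4) g g_dom
      unfolding weakly_measurable_operators_def square_integrable_def h_def by blast
    define A where "A = (\<lambda>n::nat. {- real n..real n} \<inter> {t. (norm (h t))\<^sup>2 \<le> real n})"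
    \<comment> \<open>Separability enters here: it makes the norm of a weakly measurable function
      measurable.\<close>
    have "{t \<in> space lebesgue. (norm (h t))\<^sup>2 \<le> real n} \<in> sets lebesgue" for n
      using weakly_measurable_norm_power2[OF h] by (rule borel_measurable_le) simp
    then have A: "A n \<in> sets lebesgue" for n
      unfolding A_def by (intro sets.Int) simp_all
    have exhaust: "eventually (\<lambda>n. t \<in> A n) sequentially" for t
    proof -
      \<comment> \<open>Both summands are nonnegative, so a bound on the sum bounds each of
        them.\<close>
      obtain N where N: "\<bar>t\<bar> + (norm (h t))\<^sup>2 \<le> real N"
        using real_arch_simple by blast
      have "t \<in> A n" if "n \<ge> N" for n
      proof -
        have "\<bar>t\<bar> + (norm (h t))\<^sup>2 \<le> real n" using N that by linarith
        moreover have "0 \<le> (norm (h t))\<^sup>2" by simp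
        ultimately show ?thesis
          unfolding A_def Int_iff atLeastAtMost_iff mem_Collect_eq by linarith
      qed
      then show ?thesis by (auto simp: eventually_sequentially)
    qed
    \<comment> \<open>The indicator is a scalar, so homogeneity of \<open>T t\<close> lets it pass
      through the operator.\<close>
    have cut: "indicator (A n) t *\<^sub>R g t \<in> dom (T t) \<and>
        the (T t (indicator (A n) t *\<^sub>R g t)) = indicator (A n) t *\<^sub>R h t" for n t
      using assms(1)[of t] g_dom[of t] unfolding linear_operator_def scaleR_scaleC h_def by blast
    have "abs_L2 (\<lambda>t. indicator (A n) t *\<^sub>R g t) \<in> dom (associated_operator T)" for n
    proof (rule abs_L2_in_dom_associated_operator)
      show "square_integrable (\<lambda>t. indicator (A n) t *\<^sub>R g t)"
        using g A by (rule square_integrable_indicator_scaleR)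
      \<comment> \<open>The two conditions defining \<open>A n\<close> give the support in an
        interval and the bound \<open>real n\<close>.\<close>
      have "square_integrable (\<lambda>t. indicator (A n) t *\<^sub>R h t)"
        by (rule square_integrable_bounded_support[where b = "real n" and c = "real n",
              OF weakly_measurable_indicator_scaleR[OF h A]])
          (auto simp: A_def indicator_def)
      then show "square_integrable (\<lambda>t. the (T t (indicator (A n) t *\<^sub>R g t)))"
        by (simp add: cut)
    qed (use cut in blast)
    moreover have "(\<lambda>n. abs_L2 (\<lambda>t. indicator (A n) t *\<^sub>R g t)) \<longlonglongrightarrow> abs_L2 g"
      using g A exhaust by (rule abs_L2_indicator_tendsto)
    moreover have "abs_L2 g = f"
      by (rule L2_eqI) (use rep_abs_L2[OF g] g_eq in \<open>eventually_elim, simp\<close>)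
    ultimately show ?thesis
      unfolding closure_sequential
      by (intro exI[of _ "\<lambda>n. abs_L2 (\<lambda>t. indicator (A n) t *\<^sub>R g t)"]) simp
  qed
  then show "closure D \<subseteq> closure (dom (associated_operator T))"
    by (intro closure_minimal) auto
qed

end
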